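(* Let $Q$ be a quandle such that the natural map $Q\to G_Q$, which maps an element of $Q$ to the corresponding generator of $G_Q$, is injective (so that $Q$ is regarded as a subset of $G_Q$). Let $\mathrm{Aut}_Q(G_Q)$ denote the subgroup of $\mathrm{Aut}(G_Q)$ consisting of the automorphisms which keep $Q$ invariant. Then the natural map $\phi:\mathrm{Aut}_Q(G_Q) \to \mathrm{Aut}(Q)$ given by $\phi(f) = f|_Q$ is an isomorphism of groups.
   Context: A quandle is a set $Q$ with a binary operation $*$ such that (1) $x*x=x$ for all $x\in Q$; (2) for every $x\in Q$ the map $y\mapsto y*x$ is a bijection of $Q$; (3) $(x*y)*z=(x*z)*(y*z)$ for all $x,y,z\in Q$. $\mathrm{Aut}(Q)$ is the group of bijections $\varphi$ of $Q$ with $\varphi(x*y)=\varphi(x)*\varphi(y)$ for all $x,y$. The enveloping group $G_Q$ of $Q$ is the group with set of generators $Q$ and relations $x*y=y^{-1}xy$ for all $x,y\in Q$. An automorphism $f$ of $G_Q$ keeps $Q$ invariant if $f(Q)=Q$. *)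

theory Defs
  imports "HOL-Algebra.Bij" "HOL-Algebra.Coset"
begin

locale quandle =
  fixes Q :: "'a set" and star :: "'a \<Rightarrow> 'a \<Rightarrow> 'a"
  assumes closed: "\<lbrakk>x \<in> Q; y \<in> Q\<rbrakk> \<Longrightarrow> star x y \<in> Q"
    and idem: "x \<in> Q \<Longrightarrow> star x x = x"
    and bij_right: "x \<in> Q \<Longrightarrow> bij_betw (\<lambda>y. star y x) Q Q"
    and distrib: "\<lbrakk>x \<in> Q; y \<in> Q; z \<in> Q\<rbrakk> \<Longrightarrow>
      star (star x y) z = star (star x z) (star y z)"

text \<open>As in \<open>auto\<close> of \<open>HOL-Algebra\<close>, automorphisms are made extensional (\<open>undefined\<close>
  outside \<open>Q\<close>), so that each automorphism is represented by exactly one HOL function.\<close>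

definition quandle_auto :: "'a set \<Rightarrow> ('a \<Rightarrow> 'a \<Rightarrow> 'a) \<Rightarrow> ('a \<Rightarrow> 'a) set" where
  "quandle_auto Q star =
     {\<phi> \<in> Bij Q. \<forall>x\<in>Q. \<forall>y\<in>Q. \<phi> (star x y) = star (\<phi> x) (\<phi> y)}"

definition QuandleAutoGroup :: "'a set \<Rightarrow> ('a \<Rightarrow> 'a \<Rightarrow> 'a) \<Rightarrow> ('a \<Rightarrow> 'a) monoid" where
  "QuandleAutoGroup Q star = BijGroup Q \<lparr>carrier := quandle_auto Q star\<rparr>"


section \<open>Groups given by generators and relations\<close>

text \<open>The letter \<open>(x, True)\<close> stands for the generator \<open>x\<close> and \<open>(x, False)\<close> for its formal
  inverse. A relation \<open>u = v\<close> between words is represented by the pair \<open>(u, v)\<close>.\<close>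

type_synonym 'a gword = "('a \<times> bool) list"

abbreviation gwords :: "'a set \<Rightarrow> 'a gword set" where
  "gwords X \<equiv> lists (X \<times> UNIV)"

text \<open>The least congruence on words over \<open>X\<close> containing \<open>R\<close> in which \<open>(x, True)\<close> and
  \<open>(x, False)\<close> are mutually inverse.\<close>

inductive_set pres_rel :: "'a set \<Rightarrow> ('a gword \<times> 'a gword) set \<Rightarrow> ('a gword \<times> 'a gword) set"
  for X :: "'a set" and R :: "('a gword \<times> 'a gword) set" where
  relator: "\<lbrakk>(u, v) \<in> R; u \<in> gwords X; v \<in> gwords X\<rbrakk> \<Longrightarrow> (u, v) \<in> pres_rel X R"
| cancel: "x \<in> X \<Longrightarrow> ([(x, b), (x, \<not> b)], []) \<in> pres_rel X R"
| refl: "u \<in> gwords X \<Longrightarrow> (u, u) \<in> pres_rel X R"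
| sym: "(u, v) \<in> pres_rel X R \<Longrightarrow> (v, u) \<in> pres_rel X R"
| trans: "\<lbrakk>(u, v) \<in> pres_rel X R; (v, w) \<in> pres_rel X R\<rbrakk> \<Longrightarrow> (u, w) \<in> pres_rel X R"
| append: "\<lbrakk>(u, u') \<in> pres_rel X R; (v, v') \<in> pres_rel X R\<rbrakk> \<Longrightarrow>
    (u @ v, u' @ v') \<in> pres_rel X R"

definition presented_group ::
  "'a set \<Rightarrow> ('a gword \<times> 'a gword) set \<Rightarrow> 'a gword set monoid" where
  "presented_group X R =
     \<lparr>carrier = gwords X // pres_rel X R,
      mult = \<lambda>A B. \<Union>u\<in>A. \<Union>v\<in>B. pres_rel X R `` {u @ v},
      one = pres_rel X R `` {[]}\<rparr>"


section \<open>The enveloping group of a quandle\<close>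

text \<open>The relations \<open>x * y = y\<inverse> x y\<close>.\<close>

definition env_rels :: "'a set \<Rightarrow> ('a \<Rightarrow> 'a \<Rightarrow> 'a) \<Rightarrow> ('a gword \<times> 'a gword) set" where
  "env_rels Q star =
     {([(star x y, True)], [(y, False), (x, True), (y, True)]) |x y. x \<in> Q \<and> y \<in> Q}"

definition env_group :: "'a set \<Rightarrow> ('a \<Rightarrow> 'a \<Rightarrow> 'a) \<Rightarrow> 'a gword set monoid" where
  "env_group Q star = presented_group Q (env_rels Q star)"

text \<open>The natural map \<open>Q \<rightarrow> G\<^sub>Q\<close>.\<close>

definition env_gen :: "'a set \<Rightarrow> ('a \<Rightarrow> 'a \<Rightarrow> 'a) \<Rightarrow> 'a \<Rightarrow> 'a gword set" where
  "env_gen Q star x = pres_rel Q (env_rels Q star) `` {[(x, True)]}"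

definition auto_keeping :: "('g, 'c) monoid_scheme \<Rightarrow> 'g set \<Rightarrow> ('g \<Rightarrow> 'g) set" where
  "auto_keeping G S = {f \<in> auto G. f ` S = S}"

text \<open>\<open>Aut\<^sub>Q(G\<^sub>Q)\<close>, where \<open>Q\<close> is regarded as a subset of \<open>G\<^sub>Q\<close> through \<open>env_gen\<close>.\<close>

definition EnvAutoGroup ::
  "'a set \<Rightarrow> ('a \<Rightarrow> 'a \<Rightarrow> 'a) \<Rightarrow> ('a gword set \<Rightarrow> 'a gword set) monoid" where
  "EnvAutoGroup Q star = AutoGroup (env_group Q star)
     \<lparr>carrier := auto_keeping (env_group Q star) (env_gen Q star ` Q)\<rparr>"

text \<open>The map \<open>f \<mapsto> f|\<^sub>Q\<close>: the restriction of \<open>f\<close> to the image of \<open>Q\<close> in \<open>G\<^sub>Q\<close>, read back on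
  \<open>Q\<close> through the natural map (meaningful when the latter is injective on \<open>Q\<close>).\<close>

definition env_restrict ::
  "'a set \<Rightarrow> ('a \<Rightarrow> 'a \<Rightarrow> 'a) \<Rightarrow> ('a gword set \<Rightarrow> 'a gword set) \<Rightarrow> 'a \<Rightarrow> 'a" where
  "env_restrict Q star f = (\<lambda>x\<in>Q. inv_into Q (env_gen Q star) (f (env_gen Q star x)))"


section \<open>The structures above are groups\<close>

lemma pres_rel_gwords:
  "(u, v) \<in> pres_rel X R \<Longrightarrow> u \<in> gwords X \<and> v \<in> gwords X"
  by (induction rule: pres_rel.induct) auto

lemma equiv_pres_rel: "equiv (gwords X) (pres_rel X R)"
  by (rule equivI)
    (auto intro!: refl_onI symI transI intro: pres_rel.intros dest: pres_rel_gwords)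

lemma presented_group_mult_class:
  assumes "u \<in> gwords X" "v \<in> gwords X"
  shows "pres_rel X R `` {u} \<otimes>\<^bsub>presented_group X R\<^esub> pres_rel X R `` {v}
    = pres_rel X R `` {u @ v}"
proof -
  let ?r = "pres_rel X R"
  have eq: "?r `` {u' @ v'} = ?r `` {u @ v}" if "u' \<in> ?r `` {u}" "v' \<in> ?r `` {v}" for u' v'
    using equiv_class_eq[OF equiv_pres_rel pres_rel.append[of u u' X R v v']] that by simp
  have mem: "u \<in> ?r `` {u}" "v \<in> ?r `` {v}"
    using pres_rel.refl[OF assms(1)] pres_rel.refl[OF assms(2)] by simp_all
  have "(\<Union>u'\<in>?r `` {u}. \<Union>v'\<in>?r `` {v}. ?r `` {u' @ v'})
    = (\<Union>u'\<in>?r `` {u}. \<Union>v'\<in>?r `` {v}. ?r `` {u @ v})"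
    by (intro SUP_cong HOL.refl eq)
  also have "\<dots> = ?r `` {u @ v}"
    using mem by blast
  finally show ?thesis
    by (simp add: presented_group_def)
qed

lemma pres_rel_inverse:
  "u \<in> gwords X \<Longrightarrow> (map (\<lambda>(x, b). (x, \<not> b)) (rev u) @ u, []) \<in> pres_rel X R"
proof (induction u)
  case Nil
  then show ?case by (auto intro: pres_rel.refl)
next
  case (Cons a u)
  obtain x b where a: "a = (x, b)" by (cases a)
  let ?w = "map (\<lambda>(x, b). (x, \<not> b)) (rev u)"
  have x: "x \<in> X" and u: "u \<in> gwords X" using Cons.prems a by auto
  have w: "?w \<in> gwords X" using u by (auto simp: in_lists_conv_set)
  have "([(x, \<not> b), (x, b)], []) \<in> pres_rel X R"
    using pres_rel.cancel[OF x, of "\<not> b"] by simp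
  then have "(?w @ ([(x, \<not> b), (x, b)] @ u), ?w @ ([] @ u)) \<in> pres_rel X R"
    by (intro pres_rel.append pres_rel.refl u w)
  then have "(?w @ ([(x, \<not> b), (x, b)] @ u), []) \<in> pres_rel X R"
    using Cons.IH[OF u] by (auto intro: pres_rel.trans)
  then show ?case by (simp add: a)
qed

lemma group_presented_group: "group (presented_group X R)"
proof (rule groupI)
  note m = presented_group_mult_class
  have carr: "A \<in> carrier (presented_group X R) \<longleftrightarrow> (\<exists>u\<in>gwords X. A = pres_rel X R `` {u})" for A
    by (auto simp: presented_group_def quotient_def)
  have one: "\<one>\<^bsub>presented_group X R\<^esub> = pres_rel X R `` {[]}"
    by (simp add: presented_group_def)
  let ?G = "presented_group X R"
  show "A \<otimes>\<^bsub>?G\<^esub> B \<in> carrier ?G" if ABC: "A \<in> carrier ?G" "B \<in> carrier ?G" for A B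
  proof -
    obtain u v where "u \<in> gwords X" "v \<in> gwords X"
      "A = pres_rel X R `` {u}" "B = pres_rel X R `` {v}"
      using ABC unfolding carr by blast
    then show ?thesis
      unfolding carr by (intro bexI[of _ "u @ v"]) (simp_all only: m append_in_lists_conv simp_thms)
  qed
  show "\<one>\<^bsub>?G\<^esub> \<in> carrier ?G"
    by (auto simp: carr one)
  show "A \<otimes>\<^bsub>?G\<^esub> B \<otimes>\<^bsub>?G\<^esub> C = A \<otimes>\<^bsub>?G\<^esub> (B \<otimes>\<^bsub>?G\<^esub> C)"
    if ABC: "A \<in> carrier ?G" "B \<in> carrier ?G" "C \<in> carrier ?G" for A B C
  proof -
    obtain u v w where "u \<in> gwords X" "v \<in> gwords X" "w \<in> gwords X"
      "A = pres_rel X R `` {u}" "B = pres_rel X R `` {v}" "C = pres_rel X R `` {w}"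
      using ABC unfolding carr by blast
    then show ?thesis by (simp add: m)
  qed
  show "\<one>\<^bsub>?G\<^esub> \<otimes>\<^bsub>?G\<^esub> A = A" if ABC: "A \<in> carrier ?G" for A
  proof -
    obtain u where "u \<in> gwords X" "A = pres_rel X R `` {u}"
      using ABC unfolding carr by blast
    then show ?thesis by (simp add: one m)
  qed
  show "\<exists>B\<in>carrier ?G. B \<otimes>\<^bsub>?G\<^esub> A = \<one>\<^bsub>?G\<^esub>" if ABC: "A \<in> carrier ?G" for A
  proof -
    obtain u where u: "u \<in> gwords X" and A: "A = pres_rel X R `` {u}"
      using ABC unfolding carr by blast
    let ?w = "map (\<lambda>(x, b). (x, \<not> b)) (rev u)"
    have w: "?w \<in> gwords X" using u by (auto simp: in_lists_conv_set)
    have "pres_rel X R `` {?w @ u} = pres_rel X R `` {[]}"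
      by (rule equiv_class_eq[OF equiv_pres_rel pres_rel_inverse[OF u]])
    then have "pres_rel X R `` {?w} \<otimes>\<^bsub>?G\<^esub> A = \<one>\<^bsub>?G\<^esub>"
      by (simp only: A m[OF w u] one)
    then show ?thesis using w carr by blast
  qed
qed

lemma group_env_group: "group (env_group Q star)"
  unfolding env_group_def by (rule group_presented_group)

lemma env_gen_closed: "x \<in> Q \<Longrightarrow> env_gen Q star x \<in> carrier (env_group Q star)"
  by (auto simp: env_gen_def env_group_def presented_group_def intro!: quotientI)

lemma (in quandle) env_gen_star:
  assumes x: "x \<in> Q" and y: "y \<in> Q"
  shows "env_gen Q star (star x y) = inv\<^bsub>env_group Q star\<^esub> env_gen Q star y
    \<otimes>\<^bsub>env_group Q star\<^esub> env_gen Q star x \<otimes>\<^bsub>env_group Q star\<^esub> env_gen Q star y"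
proof -
  let ?R = "env_rels Q star"
  let ?G = "presented_group Q ?R" and ?c = "\<lambda>w. pres_rel Q ?R `` {w}"
  interpret G: group ?G by (rule group_presented_group)
  have carr: "?c w \<in> carrier ?G" if "w \<in> gwords Q" for w
    using that by (auto simp: presented_group_def intro!: quotientI)
  have "?c [(y, False)] \<otimes>\<^bsub>?G\<^esub> ?c [(y, True)] = ?c [(y, False), (y, True)]"
    using y by (simp add: presented_group_mult_class)
  also have "\<dots> = \<one>\<^bsub>?G\<^esub>"
    using equiv_class_eq[OF equiv_pres_rel pres_rel.cancel[OF y, of False]]
    by (simp add: presented_group_def)
  finally have inv: "inv\<^bsub>?G\<^esub> ?c [(y, True)] = ?c [(y, False)]"
    using y by (intro G.inv_equality carr) auto
  have "?c [(star x y, True)] = ?c [(y, False), (x, True), (y, True)]"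
    using x y closed[OF x y]
    by (intro equiv_class_eq[OF equiv_pres_rel] pres_rel.relator) (auto simp: env_rels_def)
  also have "\<dots> = ?c [(y, False)] \<otimes>\<^bsub>?G\<^esub> ?c [(x, True)] \<otimes>\<^bsub>?G\<^esub> ?c [(y, True)]"
    using x y by (simp add: presented_group_mult_class)
  finally show ?thesis
    unfolding env_gen_def env_group_def inv .
qed

lemma (in quandle) subgroup_quandle_auto: "subgroup (quandle_auto Q star) (BijGroup Q)"
proof (rule group.subgroupI[OF group_BijGroup])
  show "quandle_auto Q star \<subseteq> carrier (BijGroup Q)"
    by (auto simp: quandle_auto_def BijGroup_def)
  have "(\<lambda>x\<in>Q. x) \<in> quandle_auto Q star"
    using id_Bij[of Q] closed by (auto simp: quandle_auto_def)
  then show "quandle_auto Q star \<noteq> {}" by blast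
  show "inv\<^bsub>BijGroup Q\<^esub> f \<in> quandle_auto Q star" if "f \<in> quandle_auto Q star" for f
  proof -
    have f: "f \<in> Bij Q" and
      h: "\<And>x y. \<lbrakk>x \<in> Q; y \<in> Q\<rbrakk> \<Longrightarrow> f (star x y) = star (f x) (f y)"
      using that by (auto simp: quandle_auto_def)
    have "inv_into Q f (star x y) = star (inv_into Q f x) (inv_into Q f y)"
      if "x \<in> Q" "y \<in> Q" for x y
      by (rule Bij_inv_into_lemma[where g = star, OF h f _ that]) (auto intro: closed)
    then show ?thesis
      using restrict_inv_into_Bij[OF f] closed
      by (simp add: inv_BijGroup[OF f] quandle_auto_def)
  qed
  show "f \<otimes>\<^bsub>BijGroup Q\<^esub> g \<in> quandle_auto Q star"
    if "f \<in> quandle_auto Q star" "g \<in> quandle_auto Q star" for f g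
  proof -
    have "g x \<in> Q" if "x \<in> Q" for x
      using that \<open>g \<in> quandle_auto Q star\<close>
      by (auto simp: quandle_auto_def dest: Bij_imp_funcset)
    then show ?thesis
      using that closed compose_Bij[of f Q g]
      by (simp add: quandle_auto_def BijGroup_def compose_eq)
  qed
qed

lemma (in quandle) group_QuandleAutoGroup: "group (QuandleAutoGroup Q star)"
  unfolding QuandleAutoGroup_def
  by (rule subgroup.subgroup_is_group[OF subgroup_quandle_auto group_BijGroup])

lemma (in group) subgroup_auto_keeping:
  assumes S: "S \<subseteq> carrier G"
  shows "subgroup (auto_keeping G S) (AutoGroup G)"
proof -
  let ?B = "BijGroup (carrier G)"
  have "subgroup (auto_keeping G S) ?B"
  proof (rule group.subgroupI[OF group_BijGroup])
    show "auto_keeping G S \<subseteq> carrier ?B"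
      by (auto simp: auto_keeping_def auto_def BijGroup_def)
    have "(\<lambda>x\<in>carrier G. x) \<in> auto_keeping G S"
      using id_in_auto S by (auto simp: auto_keeping_def image_def subset_iff)
    then show "auto_keeping G S \<noteq> {}" by blast
    show "inv\<^bsub>?B\<^esub> f \<in> auto_keeping G S" if "f \<in> auto_keeping G S" for f
    proof -
      have f: "f \<in> auto G" "f \<in> Bij (carrier G)" "f ` S = S"
        using that by (auto simp: auto_keeping_def auto_def)
      then have inj: "inj_on f (carrier G)" by (auto simp: Bij_def bij_betw_def)
      have "restrict (inv_into (carrier G) f) (carrier G) ` S = inv_into (carrier G) f ` S"
        using S by (intro image_cong) auto
      also have "\<dots> = inv_into (carrier G) f ` f ` S" by (simp only: f(3))
      also have "\<dots> = S" by (rule inv_into_image_cancel[OF inj S])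
      finally have "(inv\<^bsub>?B\<^esub> f) ` S = S" using inv_BijGroup[OF f(2)] by simp
      moreover have "inv\<^bsub>?B\<^esub> f \<in> auto G"
        using subgroup.m_inv_closed[OF subgroup_auto f(1)] .
      ultimately show ?thesis by (simp add: auto_keeping_def)
    qed
    show "f \<otimes>\<^bsub>?B\<^esub> g \<in> auto_keeping G S"
      if "f \<in> auto_keeping G S" "g \<in> auto_keeping G S" for f g
    proof -
      have fg: "f \<in> auto G" "g \<in> auto G" "f ` S = S" "g ` S = S"
        using that by (auto simp: auto_keeping_def)
      then have eq: "f \<otimes>\<^bsub>?B\<^esub> g = compose (carrier G) f g"
        by (auto simp: BijGroup_def auto_def)
      have "compose (carrier G) f g ` S = f ` g ` S"
        unfolding image_image using S by (intro image_cong) (auto simp: compose_eq)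
      then show ?thesis
        using subgroup.m_closed[OF subgroup_auto fg(1,2)] fg(3,4) eq
        by (simp add: auto_keeping_def)
    qed
  qed
  then show ?thesis
    unfolding AutoGroup_def
    by (rule group.subgroup_incl[OF group_BijGroup _ subgroup_auto])
      (auto simp: auto_keeping_def)
qed

lemma group_EnvAutoGroup: "group (EnvAutoGroup Q star)"
proof -
  have S: "env_gen Q star ` Q \<subseteq> carrier (env_group Q star)"
    by (auto intro: env_gen_closed)
  show ?thesis
    unfolding EnvAutoGroup_def
    by (rule subgroup.subgroup_is_group[OF
          group.subgroup_auto_keeping[OF group_env_group S]
          group.AutoGroup[OF group_env_group]])
qed

end

theory Submission
  imports Defs
begin

text \<open>The enveloping group is functorial in the quandle, so every automorphism of \<open>Q\<close> induces one
  of \<open>G\<^sub>Q\<close> that permutes the generators in the same way; this gives surjectivity. Injectivity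
  holds because \<open>Q\<close> generates \<open>G\<^sub>Q\<close>. An automorphism of \<open>G\<^sub>Q\<close> preserving \<open>Q\<close> restricts to a
  quandle automorphism because \<open>x * y\<close> is the conjugate of \<open>x\<close> by \<open>y\<close> in \<open>G\<^sub>Q\<close>.\<close>

section \<open>Maps between presented groups\<close>

abbreviation gword_map :: "('a \<Rightarrow> 'b) \<Rightarrow> 'a gword \<Rightarrow> 'b gword" where
  "gword_map \<phi> \<equiv> map (map_prod \<phi> id)"

lemma gword_map_closed: "\<lbrakk>\<phi> \<in> X \<rightarrow> Y; u \<in> gwords X\<rbrakk> \<Longrightarrow> gword_map \<phi> u \<in> gwords Y"
  by (auto simp: in_lists_conv_set)

lemma gword_map_inverse:
  assumes "\<And>x. x \<in> X \<Longrightarrow> \<psi> (\<phi> x) = x" and "u \<in> gwords X"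
  shows "gword_map \<psi> (gword_map \<phi> u) = u"
  using assms by (auto simp: in_lists_conv_set intro!: map_idI)

text \<open>Only the relators need checking: cancellation and the congruence rules are respected by
  any letterwise map that keeps signs. A relator may be sent to any consequence of \<open>S\<close>,
  not just to an element of \<open>S\<close>.\<close>

lemma pres_rel_map:
  assumes \<phi>: "\<phi> \<in> X \<rightarrow> Y"
    and rel: "\<And>u v. \<lbrakk>(u, v) \<in> R; u \<in> gwords X; v \<in> gwords X\<rbrakk> \<Longrightarrow>
      (gword_map \<phi> u, gword_map \<phi> v) \<in> pres_rel Y S"
    and uv: "(u, v) \<in> pres_rel X R"
  shows "(gword_map \<phi> u, gword_map \<phi> v) \<in> pres_rel Y S"
  using uv
proof (induction rule: pres_rel.induct)
  case (relator u v)
  then show ?case by (rule rel)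
next
  case (cancel x b)
  then show ?case using \<phi> by (auto intro: pres_rel.cancel)
next
  case (refl u)
  show ?case by (rule pres_rel.refl[OF gword_map_closed[OF \<phi> refl]])
next
  case (append u u' v v')
  then show ?case by (simp add: pres_rel.append)
qed (auto intro: pres_rel.sym pres_rel.trans)

text \<open>The union over all representatives avoids choosing one; it is a single class once the
  map respects the relations. Restricting to the carrier makes the map extensional, as membership in
  \<open>auto\<close> demands.\<close>

definition presented_map ::
  "'a set \<Rightarrow> ('a gword \<times> 'a gword) set \<Rightarrow> 'b set \<Rightarrow> ('b gword \<times> 'b gword) set \<Rightarrow>
    ('a \<Rightarrow> 'b) \<Rightarrow> 'a gword set \<Rightarrow> 'b gword set" where
  "presented_map X R Y S \<phi> =
     (\<lambda>A\<in>carrier (presented_group X R). \<Union>u\<in>A. pres_rel Y S `` {gword_map \<phi> u})"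

lemma presented_group_class_closed:
  "u \<in> gwords X \<Longrightarrow> pres_rel X R `` {u} \<in> carrier (presented_group X R)"
  by (simp add: presented_group_def quotientI)

lemma presented_group_carrierE:
  assumes "A \<in> carrier (presented_group X R)"
  obtains u where "u \<in> gwords X" "A = pres_rel X R `` {u}"
  using assms by (auto simp: presented_group_def quotient_def)

lemma presented_map_class:
  assumes \<phi>: "\<phi> \<in> X \<rightarrow> Y"
    and rel: "\<And>u v. \<lbrakk>(u, v) \<in> R; u \<in> gwords X; v \<in> gwords X\<rbrakk> \<Longrightarrow>
      (gword_map \<phi> u, gword_map \<phi> v) \<in> pres_rel Y S"
    and u: "u \<in> gwords X"
  shows "presented_map X R Y S \<phi> (pres_rel X R `` {u}) = pres_rel Y S `` {gword_map \<phi> u}"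
proof -
  have eq: "pres_rel Y S `` {gword_map \<phi> v} = pres_rel Y S `` {gword_map \<phi> u}"
    if "v \<in> pres_rel X R `` {u}" for v
    using equiv_class_eq[OF equiv_pres_rel pres_rel_map[of \<phi> X Y R S u v, OF \<phi> rel]] that
    by simp
  \<comment> \<open>A union of a constant family equals that constant only over a nonempty index
    set.\<close>
  have mem: "u \<in> pres_rel X R `` {u}"
    using pres_rel.refl[OF u] by simp
  have "(\<Union>v\<in>pres_rel X R `` {u}. pres_rel Y S `` {gword_map \<phi> v})
      = (\<Union>v\<in>pres_rel X R `` {u}. pres_rel Y S `` {gword_map \<phi> u})"
    by (intro SUP_cong HOL.refl eq)
  also have "\<dots> = pres_rel Y S `` {gword_map \<phi> u}"
    using mem by blast
  finally show ?thesis
    using presented_group_class_closed[OF u] by (simp add: presented_map_def)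
qed

lemma presented_map_hom:
  assumes \<phi>: "\<phi> \<in> X \<rightarrow> Y"
    and rel: "\<And>u v. \<lbrakk>(u, v) \<in> R; u \<in> gwords X; v \<in> gwords X\<rbrakk> \<Longrightarrow>
      (gword_map \<phi> u, gword_map \<phi> v) \<in> pres_rel Y S"
  shows "presented_map X R Y S \<phi> \<in> hom (presented_group X R) (presented_group Y S)"
proof (rule homI)
  note cl = presented_map_class[of \<phi> X Y R S, OF \<phi> rel]
  note wcl = gword_map_closed[OF \<phi>]
  show "presented_map X R Y S \<phi> A \<in> carrier (presented_group Y S)"
    if A: "A \<in> carrier (presented_group X R)" for A
    using A
    by (rule presented_group_carrierE) (simp only: cl presented_group_class_closed wcl)
  fix A B
  assume "A \<in> carrier (presented_group X R)" "B \<in> carrier (presented_group X R)"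
  then obtain u v where uv: "u \<in> gwords X" "v \<in> gwords X"
    and AB: "A = pres_rel X R `` {u}" "B = pres_rel X R `` {v}"
    by (metis presented_group_carrierE)
  have "u @ v \<in> gwords X" using uv by (simp only: append_in_lists_conv simp_thms)
  then show "presented_map X R Y S \<phi> (A \<otimes>\<^bsub>presented_group X R\<^esub> B)
      = presented_map X R Y S \<phi> A \<otimes>\<^bsub>presented_group Y S\<^esub> presented_map X R Y S \<phi> B"
    by (simp only: AB presented_group_mult_class uv wcl cl map_append)
qed

section \<open>Homomorphisms are determined by the generators\<close>

lemma presented_group_inv_generator:
  assumes x: "x \<in> X"
  shows "inv\<^bsub>presented_group X R\<^esub> (pres_rel X R `` {[(x, True)]}) = pres_rel X R `` {[(x, False)]}"
proof -
  let ?c = "\<lambda>w. pres_rel X R `` {w}"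
  have "?c [(x, False)] \<otimes>\<^bsub>presented_group X R\<^esub> ?c [(x, True)] = ?c [(x, False), (x, True)]"
    using x by (simp add: presented_group_mult_class)
  also have "\<dots> = \<one>\<^bsub>presented_group X R\<^esub>"
    using equiv_class_eq[OF equiv_pres_rel pres_rel.cancel[OF x, of False]]
    by (simp add: presented_group_def)
  finally show ?thesis
    using x by (intro group.inv_equality group_presented_group presented_group_class_closed) auto
qed

text \<open>Every element is the class of a word, hence a product of classes of single letters, so
  agreement spreads from letters to words by induction on the word.\<close>

lemma presented_group_hom_eqI:
  assumes H: "group H"
    and f: "f \<in> hom (presented_group X R) H" and g: "g \<in> hom (presented_group X R) H"
    and eq: "\<And>x. x \<in> X \<Longrightarrow> f (pres_rel X R `` {[(x, True)]}) = g (pres_rel X R `` {[(x, True)]})"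
    and A: "A \<in> carrier (presented_group X R)"
  shows "f A = g A"
proof -
  let ?c = "\<lambda>w. pres_rel X R `` {w}"
  let ?G = "presented_group X R"
  interpret f: group_hom ?G H f
    by (intro group_hom.intro group_hom_axioms.intro group_presented_group H f)
  interpret g: group_hom ?G H g
    by (intro group_hom.intro group_hom_axioms.intro group_presented_group H g)
  have letter: "f (?c [(x, b)]) = g (?c [(x, b)])" if x: "x \<in> X" for x b
  proof (cases b)
    case False
    \<comment> \<open>The class of \<open>(x, False)\<close> is the inverse of that of
      \<open>(x, True)\<close>, and homomorphisms preserve inverses.\<close>
    have "?c [(x, True)] \<in> carrier ?G"
      using x by (intro presented_group_class_closed) auto
    then have "f (inv\<^bsub>?G\<^esub> ?c [(x, True)]) = g (inv\<^bsub>?G\<^esub> ?c [(x, True)])"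
      by (simp add: eq[OF x])
    then show ?thesis using False by (simp add: presented_group_inv_generator[OF x])
  qed (use eq[OF x] in simp)
  obtain u where u: "u \<in> gwords X" and A_eq: "A = ?c u"
    using A by (rule presented_group_carrierE)
  have "f (?c u) = g (?c u)"
    using u
  proof (induction u)
    case Nil
    have "?c [] = \<one>\<^bsub>?G\<^esub>" by (simp add: presented_group_def)
    then show ?case by (metis f.hom_one g.hom_one)
  next
    case (Cons a u)
    obtain x b where a: "a = (x, b)" by (cases a)
    have w: "[(x, b)] \<in> gwords X" "u \<in> gwords X" and x: "x \<in> X"
      using Cons.prems Cons.hyps a by auto
    have "?c (a # u) = ?c [(x, b)] \<otimes>\<^bsub>?G\<^esub> ?c u"
      using presented_group_mult_class[OF w, of R] a by simp
    then show ?case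
      using presented_group_class_closed[OF w(1), of R] presented_group_class_closed[OF w(2), of R]
      by (simp add: letter[OF x] Cons.IH)
  qed
  then show ?thesis by (simp only: A_eq)
qed

section \<open>Automorphisms of the enveloping group\<close>

lemma quandle_autoD:
  assumes "\<phi> \<in> quandle_auto Q star"
  shows "bij_betw \<phi> Q Q" "\<phi> \<in> extensional Q"
    "\<lbrakk>x \<in> Q; y \<in> Q\<rbrakk> \<Longrightarrow> \<phi> (star x y) = star (\<phi> x) (\<phi> y)"
  using assms by (auto simp: quandle_auto_def Bij_def)

text \<open>The defining relation for the pair \<open>x\<close>, \<open>y\<close> becomes the one
  for \<open>\<phi> x\<close>, \<open>\<phi> y\<close>, because \<open>\<phi>\<close> commutes with
  \<open>star\<close>.\<close>

lemma env_rels_map: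
  assumes \<phi>: "\<phi> \<in> quandle_auto Q star"
    and uv: "(u, v) \<in> env_rels Q star" "u \<in> gwords Q" "v \<in> gwords Q"
  shows "(gword_map \<phi> u, gword_map \<phi> v) \<in> pres_rel Q (env_rels Q star)"
proof (rule pres_rel.relator)
  have \<phi>Q: "\<phi> \<in> Q \<rightarrow> Q"
    using quandle_autoD(1)[OF \<phi>] by (rule bij_betw_imp_funcset)
  show "gword_map \<phi> u \<in> gwords Q" "gword_map \<phi> v \<in> gwords Q"
    by (rule gword_map_closed[OF \<phi>Q uv(2)], rule gword_map_closed[OF \<phi>Q uv(3)])
  show "(gword_map \<phi> u, gword_map \<phi> v) \<in> env_rels Q star"
    using uv(1) \<phi>Q by (force simp: env_rels_def quandle_autoD(3)[OF \<phi>])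
qed

definition env_map :: "'a set \<Rightarrow> ('a \<Rightarrow> 'a \<Rightarrow> 'a) \<Rightarrow> ('a \<Rightarrow> 'a) \<Rightarrow> 'a gword set \<Rightarrow> 'a gword set" where
  "env_map Q star = presented_map Q (env_rels Q star) Q (env_rels Q star)"

lemma env_map_class:
  assumes \<phi>: "\<phi> \<in> quandle_auto Q star" and u: "u \<in> gwords Q"
  shows "env_map Q star \<phi> (pres_rel Q (env_rels Q star) `` {u})
    = pres_rel Q (env_rels Q star) `` {gword_map \<phi> u}"
  unfolding env_map_def
  using quandle_autoD(1)[OF \<phi>] env_rels_map[OF \<phi>] u
  by (intro presented_map_class) (auto dest: bij_betw_imp_funcset)

lemma env_map_gen:
  assumes "\<phi> \<in> quandle_auto Q star" "x \<in> Q"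
  shows "env_map Q star \<phi> (env_gen Q star x) = env_gen Q star (\<phi> x)"
  using env_map_class[OF assms(1), of "[(x, True)]"] assms(2) by (simp add: env_gen_def)

lemma env_map_hom:
  assumes \<phi>: "\<phi> \<in> quandle_auto Q star"
  shows "env_map Q star \<phi> \<in> hom (env_group Q star) (env_group Q star)"
  unfolding env_map_def env_group_def
  using quandle_autoD(1)[OF \<phi>] env_rels_map[OF \<phi>]
  by (intro presented_map_hom) (auto dest: bij_betw_imp_funcset)

text \<open>On representatives the composite applies \<open>\<psi>\<close> after
  \<open>\<phi>\<close> to each letter, which restores the word. Stated one-sidedly so that it
  serves for both orders of a mutually inverse pair.\<close>

lemma env_map_inverse:
  assumes \<phi>: "\<phi> \<in> quandle_auto Q star" and \<psi>: "\<psi> \<in> quandle_auto Q star"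
    and inv: "\<And>x. x \<in> Q \<Longrightarrow> \<psi> (\<phi> x) = x"
    and A: "A \<in> carrier (env_group Q star)"
  shows "env_map Q star \<psi> (env_map Q star \<phi> A) = A"
proof -
  obtain u where u: "u \<in> gwords Q" and A: "A = pres_rel Q (env_rels Q star) `` {u}"
    using A unfolding env_group_def by (rule presented_group_carrierE)
  have "gword_map \<phi> u \<in> gwords Q"
    using quandle_autoD(1)[OF \<phi>] u by (intro gword_map_closed) (auto dest: bij_betw_imp_funcset)
  then show ?thesis
    by (simp only: A env_map_class[OF \<phi> u] env_map_class[OF \<psi>] gword_map_inverse[where X = Q and \<phi> = \<phi> and \<psi> = \<psi>, OF inv u])
qed

lemma (in quandle) quandle_auto_inverse:
  assumes \<phi>: "\<phi> \<in> quandle_auto Q star"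
  obtains \<psi> where "\<psi> \<in> quandle_auto Q star"
    "\<And>x. x \<in> Q \<Longrightarrow> \<psi> (\<phi> x) = x" "\<And>x. x \<in> Q \<Longrightarrow> \<phi> (\<psi> x) = x"
proof
  have B: "\<phi> \<in> Bij Q" and b: "bij_betw \<phi> Q Q"
    using \<phi> by (auto simp: quandle_auto_def Bij_def)
  have "inv\<^bsub>BijGroup Q\<^esub> \<phi> \<in> quandle_auto Q star"
    using subgroup.m_inv_closed[OF subgroup_quandle_auto \<phi>] .
  then show "restrict (inv_into Q \<phi>) Q \<in> quandle_auto Q star"
    by (simp add: inv_BijGroup[OF B])
  show "restrict (inv_into Q \<phi>) Q (\<phi> x) = x" "\<phi> (restrict (inv_into Q \<phi>) Q x) = x"
    if "x \<in> Q" for x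
    using that bij_betwE[OF b] bij_betw_inv_into_left[OF b] bij_betw_inv_into_right[OF b] by auto
qed

text \<open>Bijectivity comes from the map induced by the inverse of \<open>\<phi>\<close>. The
  generators are permuted as \<open>\<phi>\<close> permutes \<open>Q\<close>, so their set is kept
  invariant.\<close>

lemma (in quandle) env_map_auto_keeping:
  assumes \<phi>: "\<phi> \<in> quandle_auto Q star"
  shows "env_map Q star \<phi> \<in> auto_keeping (env_group Q star) (env_gen Q star ` Q)"
proof -
  let ?G = "env_group Q star" and ?F = "env_map Q star"
  obtain \<psi> where \<psi>: "\<psi> \<in> quandle_auto Q star"
    and inv: "\<And>x. x \<in> Q \<Longrightarrow> \<psi> (\<phi> x) = x" "\<And>x. x \<in> Q \<Longrightarrow> \<phi> (\<psi> x) = x"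
    using quandle_auto_inverse[OF \<phi>] by blast
  have hom: "?F \<phi> \<in> hom ?G ?G" "?F \<psi> \<in> hom ?G ?G"
    using \<phi> \<psi> by (auto intro: env_map_hom)
  have "bij_betw (?F \<phi>) (carrier ?G) (carrier ?G)"
    by (rule bij_betw_byWitness[where f' = "?F \<psi>"])
      (use hom env_map_inverse[OF \<phi> \<psi> inv(1)] env_map_inverse[OF \<psi> \<phi> inv(2)]
        in \<open>auto simp: hom_def\<close>)
  moreover have "?F \<phi> \<in> extensional (carrier ?G)"
    by (simp add: env_map_def presented_map_def env_group_def)
  moreover have "?F \<phi> ` env_gen Q star ` Q = env_gen Q star ` \<phi> ` Q"
    unfolding image_image by (intro image_cong) (auto simp: env_map_gen[OF \<phi>])
  ultimately show ?thesis
    using hom(1) bij_betw_imp_surj_on[OF quandle_autoD(1)[OF \<phi>]]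
    by (simp add: auto_keeping_def auto_def Bij_def)
qed

section \<open>Restriction of automorphisms to the generators\<close>

lemma auto_keepingD:
  assumes "f \<in> auto_keeping G S"
  shows "f \<in> hom G G" "bij_betw f (carrier G) (carrier G)" "f \<in> extensional (carrier G)"
    "f ` S = S"
  using assms by (auto simp: auto_keeping_def auto_def Bij_def)

text \<open>Invariance puts \<open>f (env_gen Q star x)\<close> into the image of \<open>Q\<close>,
  so \<open>inv_into\<close> returns a genuine preimage rather than an arbitrary value.\<close>

lemma env_restrict_gen:
  assumes f: "f ` env_gen Q star ` Q = env_gen Q star ` Q" and x: "x \<in> Q"
  shows "env_restrict Q star f x \<in> Q"
    and "env_gen Q star (env_restrict Q star f x) = f (env_gen Q star x)"
proof -
  have "f (env_gen Q star x) \<in> env_gen Q star ` Q"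
    using f x by blast
  then show "env_restrict Q star f x \<in> Q"
    and "env_gen Q star (env_restrict Q star f x) = f (env_gen Q star x)"
    using x by (simp_all add: env_restrict_def inv_into_into f_inv_into_f)
qed

text \<open>Injectivity makes the preimage unique, so values of the restriction can be computed by
  comparing elements of the enveloping group.\<close>

lemma env_restrict_eqI:
  assumes inj: "inj_on (env_gen Q star) Q"
    and "x \<in> Q" "y \<in> Q" "f (env_gen Q star x) = env_gen Q star y"
  shows "env_restrict Q star f x = y"
  using assms by (simp add: env_restrict_def)

lemma (in quandle) env_restrict_quandle_auto:
  assumes inj: "inj_on (env_gen Q star) Q"
    and f: "f \<in> auto_keeping (env_group Q star) (env_gen Q star ` Q)"
  shows "env_restrict Q star f \<in> quandle_auto Q star"
proof -
  let ?G = "env_group Q star" and ?g = "env_gen Q star" and ?r = "env_restrict Q star f"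
  note fD = auto_keepingD[OF f]
  note r = env_restrict_gen[OF fD(4)]
  interpret f: group_hom ?G ?G f
    by (intro group_hom.intro group_hom_axioms.intro group_env_group fD(1))
  have "inj_on ?r Q"
  proof (rule inj_onI)
    fix x y assume xy: "x \<in> Q" "y \<in> Q" and "?r x = ?r y"
    then have "f (?g x) = f (?g y)" using r(2) by metis
    then have "?g x = ?g y"
      \<comment> \<open>\<open>f\<close> is injective on the whole carrier, which contains the
        generators.\<close>
      using xy env_gen_closed[of _ Q star] bij_betw_imp_inj_on[OF fD(2)] by (metis inj_onD)
    then show "x = y" using inj xy by (metis inj_onD)
  qed
  moreover have "?r ` Q = Q"
  proof
    show "?r ` Q \<subseteq> Q" using r(1) by auto
    show "Q \<subseteq> ?r ` Q"
    proof
      fix y assume y: "y \<in> Q"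
      then obtain x where x: "x \<in> Q" "f (?g x) = ?g y"
        using fD(4) by (metis (no_types, lifting) imageE imageI)
      then show "y \<in> ?r ` Q" using env_restrict_eqI[where f = f, OF inj x(1) y x(2)] by blast
    qed
  qed
  moreover have "?r (star x y) = star (?r x) (?r y)" if xy: "x \<in> Q" "y \<in> Q" for x y
  proof (rule env_restrict_eqI[OF inj closed[OF xy] closed[OF r(1) r(1)]])
    \<comment> \<open>By \<open>env_gen_star\<close> both sides unfold to conjugates of generators,
      and the homomorphism \<open>f\<close> carries conjugates to conjugates.\<close>
    show "f (?g (star x y)) = ?g (star (?r x) (?r y))"
      using xy by (simp add: env_gen_star r env_gen_closed)
  qed (use xy in auto)
  moreover have "?r \<in> extensional Q" by (simp add: env_restrict_def)
  ultimately show ?thesis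
    by (simp add: quandle_auto_def Bij_def bij_betw_def)
qed

text \<open>This exhibits \<open>env_map Q star \<phi>\<close> as the preimage of
  \<open>\<phi>\<close> needed for surjectivity. The two sides agree on \<open>Q\<close> by
  \<open>env_map_gen\<close> and off \<open>Q\<close> by extensionality.\<close>

lemma env_restrict_env_map:
  assumes inj: "inj_on (env_gen Q star) Q" and \<phi>: "\<phi> \<in> quandle_auto Q star"
  shows "env_restrict Q star (env_map Q star \<phi>) = \<phi>"
proof (rule extensionalityI[of _ Q])
  show "env_restrict Q star (env_map Q star \<phi>) x = \<phi> x" if x: "x \<in> Q" for x
    using x bij_betwE[OF quandle_autoD(1)[OF \<phi>]] env_map_gen[OF \<phi> x]
    by (intro env_restrict_eqI[OF inj]) auto
qed (use quandle_autoD(2)[OF \<phi>] in \<open>simp_all add: env_restrict_def\<close>)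

text \<open>Equal restrictions give equal values on the generators, hence on the whole carrier;
  extensionality settles the remaining arguments.\<close>

lemma env_restrict_inj:
  "inj_on (env_restrict Q star) (auto_keeping (env_group Q star) (env_gen Q star ` Q))"
proof (rule inj_onI)
  let ?G = "env_group Q star" and ?S = "env_gen Q star ` Q"
  fix f h
  assume f: "f \<in> auto_keeping ?G ?S" and h: "h \<in> auto_keeping ?G ?S"
    and eq: "env_restrict Q star f = env_restrict Q star h"
  note fD = auto_keepingD[OF f] and hD = auto_keepingD[OF h]
  have gen: "f (env_gen Q star x) = h (env_gen Q star x)" if "x \<in> Q" for x
    using env_restrict_gen(2)[OF fD(4) that] env_restrict_gen(2)[OF hD(4) that] eq by simp
  show "f = h"
  proof (rule extensionalityI[OF fD(3) hD(3)])
    show "f A = h A" if "A \<in> carrier ?G" for A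
      using presented_group_hom_eqI[OF group_env_group, of f Q "env_rels Q star" Q star h A]
        fD(1) hD(1) gen that
      by (simp add: env_group_def env_gen_def)
  qed
qed

text \<open>At \<open>x\<close> in \<open>Q\<close>, the generator of either side is
  \<open>f (h (env_gen Q star x))\<close>, so the injectivity of \<open>env_gen\<close> identifies
  the two values.\<close>

lemma env_restrict_compose:
  assumes inj: "inj_on (env_gen Q star) Q"
    and f: "f ` env_gen Q star ` Q = env_gen Q star ` Q"
    and h: "h ` env_gen Q star ` Q = env_gen Q star ` Q"
  shows "env_restrict Q star (compose (carrier (env_group Q star)) f h)
    = compose Q (env_restrict Q star f) (env_restrict Q star h)"
proof (rule extensionalityI[of _ Q])
  note rf = env_restrict_gen[OF f] and rh = env_restrict_gen[OF h]
  fix x assume x: "x \<in> Q"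
  show "env_restrict Q star (compose (carrier (env_group Q star)) f h) x
      = compose Q (env_restrict Q star f) (env_restrict Q star h) x"
    using x rf[OF rh(1)[OF x]] rh[OF x]
    by (intro env_restrict_eqI[OF inj]) (simp_all add: compose_eq env_gen_closed)
qed (simp_all add: env_restrict_def)

theorem proposition3p4:
  fixes Q :: "'a set" and star :: "'a \<Rightarrow> 'a \<Rightarrow> 'a"
  assumes "quandle Q star"
    and "inj_on (env_gen Q star) Q"
  shows "env_restrict Q star \<in> iso (EnvAutoGroup Q star) (QuandleAutoGroup Q star)"
proof (rule isoI)
  interpret quandle Q star by fact
  note inj = assms(2)
  let ?K = "auto_keeping (env_group Q star) (env_gen Q star ` Q)"
  have carr: "carrier (EnvAutoGroup Q star) = ?K"
    "carrier (QuandleAutoGroup Q star) = quandle_auto Q star"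
    by (simp_all add: EnvAutoGroup_def QuandleAutoGroup_def)
  \<comment> \<open>The product in \<open>BijGroup\<close> is itself restricted to bijections, so it
    reduces to \<open>compose\<close> only for arguments known to lie in the carrier.\<close>
  have mult: "f \<otimes>\<^bsub>EnvAutoGroup Q star\<^esub> h = compose (carrier (env_group Q star)) f h"
    if "f \<in> ?K" "h \<in> ?K" for f h
    using that
    by (simp add: EnvAutoGroup_def AutoGroup_def BijGroup_def auto_keeping_def auto_def)
  have mult': "\<phi> \<otimes>\<^bsub>QuandleAutoGroup Q star\<^esub> \<psi> = compose Q \<phi> \<psi>"
    if "\<phi> \<in> quandle_auto Q star" "\<psi> \<in> quandle_auto Q star" for \<phi> \<psi>
    using that by (simp add: QuandleAutoGroup_def BijGroup_def quandle_auto_def)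
  note auto = env_restrict_quandle_auto[OF inj]
  show "env_restrict Q star \<in> hom (EnvAutoGroup Q star) (QuandleAutoGroup Q star)"
    by (rule homI)
      (simp_all add: carr auto mult mult' env_restrict_compose[OF inj] auto_keepingD(4))
  have "env_restrict Q star ` ?K = quandle_auto Q star"
  proof
    show "env_restrict Q star ` ?K \<subseteq> quandle_auto Q star" using auto by blast
    show "quandle_auto Q star \<subseteq> env_restrict Q star ` ?K"
      using env_restrict_env_map[OF inj] env_map_auto_keeping by (metis imageI subsetI)
  qed
  then show "bij_betw (env_restrict Q star)
      (carrier (EnvAutoGroup Q star)) (carrier (QuandleAutoGroup Q star))"
    using env_restrict_inj by (simp add: carr bij_betw_def)
qed

end
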